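(* Let $G$ be a finite simple graph on $n$ vertices with at least one edge, and let $R=\mathbb{K}[V(G)]$ for a field $\mathbb{K}$. Then $$\mathrm{v}(I(G))+\deg\big(h_{R/I(G)}(t)\big)\le n.$$ Moreover, equality holds if and only if $G$ is a disjoint union of star graphs $K_{1,m_1},\ldots,K_{1,m_k}$ with all $m_j\ge1$ (in particular $G$ has no isolated vertices).
   Context: $I(G)=(x_ix_j\mid\{x_i,x_j\}\in E(G))$ is the edge ideal. The v-number of a proper graded ideal $I\subseteq R$ is $\mathrm{v}(I)=\min\{d\ge0\mid\exists f\in R_d,\ \mathfrak p\in\mathrm{Ass}(I),\ I:(f)=\mathfrak p\}$. The Hilbert series of $R/I$ is written uniquely as $h_{R/I}(t)/(1-t)^{\dim(R/I)}$ with $h_{R/I}(t)\in\mathbb{Z}[t]$, $h_{R/I}(1)\ne0$; $h_{R/I}(t)$ is the $h$-polynomial. The star graph $K_{1,m}$ has vertices $x_0,x_1,\ldots,x_m$ and edges $\{x_0,x_i\}$, $1\le i\le m$. *)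

theory Defs
  imports Main "HOL-Library.Poly_Mapping" "HOL-Library.Disjoint_Sets"
    "HOL-Computational_Algebra.Polynomial_FPS"
begin

text \<open>Polynomial ring K[x_v : v in 'v] as finitely supported maps from monomials
  (exponent vectors 'v =>0 nat) to coefficients in the field 'k.\<close>

type_synonym ('v,'k) mpoly = "('v \<Rightarrow>\<^sub>0 nat) \<Rightarrow>\<^sub>0 'k"

definition mon_deg :: "('v \<Rightarrow>\<^sub>0 nat) \<Rightarrow> nat" where
  "mon_deg m = (\<Sum>v\<in>Poly_Mapping.keys m. Poly_Mapping.lookup m v)"

definition homog :: "nat \<Rightarrow> ('v,'k::zero) mpoly set" where
  "homog d = {f. \<forall>m\<in>Poly_Mapping.keys f. mon_deg m = d}"

definition is_ideal :: "('v,'k::comm_ring_1) mpoly set \<Rightarrow> bool" where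
  "is_ideal I \<longleftrightarrow> 0 \<in> I \<and> (\<forall>a\<in>I. \<forall>b\<in>I. a + b \<in> I) \<and> (\<forall>a\<in>I. \<forall>r. r * a \<in> I)"

definition is_prime_ideal :: "('v,'k::comm_ring_1) mpoly set \<Rightarrow> bool" where
  "is_prime_ideal P \<longleftrightarrow> is_ideal P \<and> P \<noteq> UNIV \<and> (\<forall>a b. a * b \<in> P \<longrightarrow> a \<in> P \<or> b \<in> P)"

definition colon :: "('v,'k::comm_ring_1) mpoly set \<Rightarrow> ('v,'k) mpoly \<Rightarrow> ('v,'k) mpoly set" where
  "colon I f = {g. g * f \<in> I}"

definition Ass :: "('v,'k::comm_ring_1) mpoly set \<Rightarrow> ('v,'k) mpoly set set" where
  "Ass I = {P. is_prime_ideal P \<and> (\<exists>f. colon I f = P)}"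

definition v_number :: "('v,'k::comm_ring_1) mpoly set \<Rightarrow> nat" where
  "v_number I = (LEAST d. \<exists>f\<in>homog d. \<exists>P\<in>Ass I. colon I f = P)"

definition edge_mon :: "'v set \<Rightarrow> ('v,'k::comm_ring_1) mpoly" where
  "edge_mon e = Poly_Mapping.single (\<Sum>v\<in>e. Poly_Mapping.single v 1) 1"

definition edge_ideal :: "'v set set \<Rightarrow> ('v,'k::comm_ring_1) mpoly set" where
  "edge_ideal E = {f. \<exists>c. f = (\<Sum>e\<in>E. c e * edge_mon e)}"

definition kscale :: "'k::field \<Rightarrow> ('v,'k) mpoly \<Rightarrow> ('v,'k) mpoly" where
  "kscale c p = Poly_Mapping.single 0 c * p"

text \<open>Hilbert function: dim_K (R/I)_d = dim_K R_d - dim_K (I intersected with R_d).\<close>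
definition hilb_fun :: "('v,'k::field) mpoly set \<Rightarrow> nat \<Rightarrow> nat" where
  "hilb_fun I d = vector_space.dim (kscale :: 'k \<Rightarrow> _) (homog d :: ('v,'k) mpoly set)
                 - vector_space.dim (kscale :: 'k \<Rightarrow> _) (I \<inter> homog d)"

definition hilb_series :: "('v,'k::field) mpoly set \<Rightarrow> int fps" where
  "hilb_series I = Abs_fps (\<lambda>d. int (hilb_fun I d))"

text \<open>h-polynomial: the unique h in Z[t] with h(1) nonzero and
  HS(t) = h(t)/(1-t)^D (the exponent D is then necessarily dim R/I).\<close>
definition h_poly :: "('v,'k::field) mpoly set \<Rightarrow> int poly" where
  "h_poly I = (THE h. poly h 1 \<noteq> 0 \<and>
      (\<exists>D::nat. hilb_series I * (1 - fps_X) ^ D = fps_of_poly h))"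

text \<open>Finite simple graph on vertex set UNIV of a finite type.\<close>
definition simple_graph :: "'v set set \<Rightarrow> bool" where
  "simple_graph E \<longleftrightarrow> (\<forall>e\<in>E. card e = 2)"

definition star_union :: "'v set set \<Rightarrow> bool" where
  "star_union E \<longleftrightarrow> (\<exists>P. partition_on UNIV P \<and>
      (\<forall>B\<in>P. \<exists>c\<in>B. card B \<ge> 2 \<and> {e\<in>E. e \<subseteq> B} = {{c, x} | x. x \<in> B - {c}}) \<and>
      (\<forall>e\<in>E. \<exists>B\<in>P. e \<subseteq> B))"

end

theory Submission
  imports Defs "HOL-Library.Countable_Set"
begin

text \<open>Let \<open>\<alpha>\<close> be the independence number. The monomials outside \<open>I = I(G)\<close> are those with independent
  support, so the numerator of the Hilbert series is \<open>\<Sum>\<^sub>S t^|S| (1 - t)^(\<alpha> - |S|)\<close> over independent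
  sets \<open>S\<close>. Hence \<open>deg h \<le> \<alpha>\<close>, with equality iff \<open>\<Sum>\<^sub>S (-1)^|S| \<noteq> 0\<close>. On the other hand the v-number
  is the least size of an independent set \<open>A\<close> whose neighbourhood \<open>N(A)\<close> is a vertex cover (then
  \<open>I : x\<^sub>A\<close> is generated by the variables in \<open>N(A)\<close>). Given an independent set \<open>S\<close> of size \<open>\<alpha>\<close>, choosing
  for every vertex outside \<open>S\<close> a neighbour in \<open>S\<close> produces such an \<open>A\<close> with \<open>|A| \<le> n - \<alpha>\<close>.

  In the case of equality there are no isolated vertices, since toggling one makes the alternating sum
  vanish. Every vertex of \<open>S\<close> has a single neighbour, otherwise the choice above could be made
  non-injective. Finally \<open>-S\<close> is independent, otherwise a maximal independent subset of \<open>-S\<close> would be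
  a smaller \<open>A\<close>. So \<open>G\<close> is a union of stars centred at \<open>-S\<close>. Conversely, in a union of stars every
  admissible \<open>A\<close> meets every star, and toggling leaves reduces the alternating sum to the single
  independent set of all centres.\<close>

section \<open>Independent sets and their neighbourhoods\<close>

definition indep :: "'v set set \<Rightarrow> 'v set \<Rightarrow> bool" where
  "indep E S \<longleftrightarrow> (\<forall>e\<in>E. \<not> e \<subseteq> S)"

definition nbhd :: "'v set set \<Rightarrow> 'v set \<Rightarrow> 'v set" where
  "nbhd E A = {v. \<exists>a\<in>A. {a, v} \<in> E}"

text \<open>\<open>nbhd E A\<close> is then even a minimal vertex cover: each of its vertices is
  joined to some \<open>a\<close> in \<open>A\<close>, and independence keeps \<open>a\<close> out
  of \<open>nbhd E A\<close>.\<close>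

definition cover_gen :: "'v set set \<Rightarrow> 'v set \<Rightarrow> bool" where
  "cover_gen E A \<longleftrightarrow> indep E A \<and> (\<forall>e\<in>E. e \<inter> nbhd E A \<noteq> {})"

text \<open>A disjoint union of stars is encoded by its centres instead of its blocks. A single-edge
  component may take either end as centre; the last clause rules out isolated centres.\<close>

definition star_centers :: "'v set set \<Rightarrow> 'v set \<Rightarrow> bool" where
  "star_centers E Z \<longleftrightarrow> (\<forall>e\<in>E. \<exists>z\<in>Z. \<exists>x. x \<notin> Z \<and> e = {z, x}) \<and>
     (\<forall>x. x \<notin> Z \<longrightarrow> (\<exists>!z. {z, x} \<in> E)) \<and> (\<forall>z\<in>Z. \<exists>x. {z, x} \<in> E)"

lemma simple_graph_edgeE:
  assumes "simple_graph E" "e \<in> E"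
  obtains a b where "a \<noteq> b" "e = {a, b}"
proof -
  have "card e = 2" using assms unfolding simple_graph_def by simp
  then show ?thesis using that by (auto simp: card_2_iff)
qed

lemma simple_graph_irrefl: "simple_graph E \<Longrightarrow> {a, b} \<in> E \<Longrightarrow> a \<noteq> b"
  by (auto simp: simple_graph_def)

lemma nbhdI: "{a, v} \<in> E \<Longrightarrow> a \<in> A \<Longrightarrow> v \<in> nbhd E A"
  and nbhdI': "{v, a} \<in> E \<Longrightarrow> a \<in> A \<Longrightarrow> v \<in> nbhd E A"
  unfolding nbhd_def by (auto simp: insert_commute)

lemma indep_subset: "indep E S \<Longrightarrow> T \<subseteq> S \<Longrightarrow> indep E T"
  unfolding indep_def by blast

lemma indep_edge: "indep E S \<Longrightarrow> {a, b} \<in> E \<Longrightarrow> a \<in> S \<Longrightarrow> b \<notin> S"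
  unfolding indep_def by auto

lemma indep_empty: "simple_graph E \<Longrightarrow> indep E {}"
  by (auto simp: indep_def simple_graph_def)

text \<open>The offending edge contains \<open>v\<close> and, having two ends, joins it to
  \<open>S\<close>.\<close>

lemma not_indep_insert:
  assumes "simple_graph E" "indep E S" "\<not> indep E (insert v S)"
  shows "v \<in> nbhd E S"
proof -
  obtain e where e: "e \<in> E" "e \<subseteq> insert v S" using assms unfolding indep_def by blast
  moreover have "\<not> e \<subseteq> S" using assms e unfolding indep_def by blast
  moreover obtain a b where "a \<noteq> b" "e = {a, b}" using assms(1) e(1) by (rule simple_graph_edgeE)
  ultimately show ?thesis unfolding nbhd_def by (auto simp: insert_commute)
qed

text \<open>Every edge meets \<open>nbhd E A\<close>, while the independent set \<open>A\<close>
  does not, so an edge inside \<open>T \<union> A\<close> needs a vertex of \<open>T\<close> in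
  \<open>nbhd E A\<close>. This computes the colon ideal on monomials.\<close>

lemma indep_Un_iff:
  assumes "simple_graph E" "cover_gen E A"
  shows "indep E (T \<union> A) \<longleftrightarrow> T \<inter> nbhd E A = {}"
proof
  assume i: "indep E (T \<union> A)"
  show "T \<inter> nbhd E A = {}"
    using i unfolding nbhd_def by (auto dest: indep_edge)
next
  assume t: "T \<inter> nbhd E A = {}"
  have "A \<inter> nbhd E A = {}" using assms(2) unfolding cover_gen_def nbhd_def by (auto dest: indep_edge)
  with t assms(2) show "indep E (T \<union> A)" unfolding indep_def cover_gen_def by blast
qed

lemma maximal_indep_extension:
  fixes E :: "('v::finite) set set"
  assumes "indep E S" "S \<subseteq> C"
  obtains B where "S \<subseteq> B" "B \<subseteq> C" "indep E B" "\<And>x. x \<in> C - B \<Longrightarrow> \<not> indep E (insert x B)"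
proof -
  have "\<exists>B\<in>{B. indep E B \<and> B \<subseteq> C}. S \<subseteq> B \<and> (\<forall>T\<in>{B. indep E B \<and> B \<subseteq> C}. B \<subseteq> T \<longrightarrow> B = T)"
    by (rule finite_has_maximal2) (use assms in auto)
  then obtain B where B: "indep E B" "B \<subseteq> C" "S \<subseteq> B"
    and max: "\<And>T. indep E T \<Longrightarrow> T \<subseteq> C \<Longrightarrow> B \<subseteq> T \<Longrightarrow> B = T" by auto
  have "\<not> indep E (insert x B)" if "x \<in> C - B" for x
    using max[of "insert x B"] that B by auto
  then show ?thesis using B that by simp
qed

section \<open>Star unions\<close>

text \<open>The blocks are the closed neighbourhoods of the centres. They are disjoint because no
  two centres are adjacent and a leaf has only one neighbour.\<close>

lemma star_centers_imp_star_union: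
  assumes E: "simple_graph E" and Z: "star_centers E Z"
  shows "star_union (E :: ('v::finite) set set)"
proof -
  define B where "B z = insert z {x. {z, x} \<in> E}" for z
  have edge: "\<exists>z\<in>Z. \<exists>x. x \<notin> Z \<and> e = {z, x}" if "e \<in> E" for e
    using Z that unfolding star_centers_def by blast
  have leaf: "\<exists>!z. {z, x} \<in> E" if "x \<notin> Z" for x
    using Z that unfolding star_centers_def by blast
  have BZ: "B z \<inter> Z = {z}" if "z \<in> Z" for z
    using edge that unfolding B_def by (fastforce simp: doubleton_eq_iff)
  have center: "z \<in> Z" if "{z, x} \<in> E" "x \<notin> Z" for x z
    using edge[OF that(1)] that(2) by (auto simp: doubleton_eq_iff)
  have disj: "B z \<inter> B z' = {}" if "z \<in> Z" "z' \<in> Z" "z \<noteq> z'" for z z'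
  proof -
    have "False" if x: "x \<in> B z" "x \<in> B z'" for x
    proof (cases "x \<in> Z")
      case True
      then have "x = z" "x = z'"
        using BZ[OF \<open>z \<in> Z\<close>] BZ[OF \<open>z' \<in> Z\<close>] x by (simp_all add: set_eq_iff) metis+
      then show False using \<open>z \<noteq> z'\<close> by simp
    next
      case False
      then have "{z, x} \<in> E" "{z', x} \<in> E" using x \<open>z \<in> Z\<close> \<open>z' \<in> Z\<close> by (auto simp: B_def)
      then show False using leaf[OF False] \<open>z \<noteq> z'\<close> by blast
    qed
    then show ?thesis by blast
  qed
  have part: "partition_on UNIV (B ` Z)"
  proof (rule partition_onI)
    show "\<Union> (B ` Z) = UNIV"
    proof -
      have "x \<in> \<Union> (B ` Z)" for x
        using leaf[of x] center[of _ x] unfolding B_def by (cases "x \<in> Z") auto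
      then show ?thesis by blast
    qed
  next
    show "disjnt p q" if "p \<in> B ` Z" "q \<in> B ` Z" "p \<noteq> q" for p q
      using that disj unfolding disjnt_def by blast
  qed (auto simp: B_def)
  have star: "\<exists>c\<in>B z. card (B z) \<ge> 2 \<and> {e\<in>E. e \<subseteq> B z} = {{c, x} | x. x \<in> B z - {c}}"
    if z: "z \<in> Z" for z
  proof (intro bexI[of _ z] conjI)
    obtain x where x: "{z, x} \<in> E" using Z z unfolding star_centers_def by blast
    then have "{z, x} \<subseteq> B z" "z \<noteq> x" using simple_graph_irrefl[OF E] by (auto simp: B_def)
    then have "card {z, x} \<le> card (B z)" by (intro card_mono) auto
    then show "2 \<le> card (B z)" using \<open>z \<noteq> x\<close> by simp
    show "{e\<in>E. e \<subseteq> B z} = {{z, x} | x. x \<in> B z - {z}}"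
    proof (intro equalityI subsetI)
      fix e assume e: "e \<in> {e\<in>E. e \<subseteq> B z}"
      then obtain z' x where zx: "z' \<in> Z" "x \<notin> Z" "e = {z', x}" using edge by blast
      then have "z' = z" using e BZ[OF z] by blast
      then show "e \<in> {{z, x} | x. x \<in> B z - {z}}" using zx e z by blast
    qed (auto simp: B_def)
  qed (simp add: B_def)
  have inB: "\<exists>b\<in>B ` Z. e \<subseteq> b" if e: "e \<in> E" for e
    using edge[OF e] e unfolding B_def by auto
  show ?thesis
    unfolding star_union_def
  proof (intro exI[of _ "B ` Z"] conjI ballI)
    fix b assume "b \<in> B ` Z"
    then obtain z where "z \<in> Z" "b = B z" by (rule imageE)
    then show "\<exists>c\<in>b. 2 \<le> card b \<and> {e\<in>E. e \<subseteq> b} = {{c, x} | x. x \<in> b - {c}}"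
      using star by simp
  qed (fact part inB)+
qed

text \<open>\<open>Z\<close> collects one chosen centre per block. An edge at a leaf lies in the
  leaf's own block, where all edges pass through the centre.\<close>

lemma star_union_imp_star_centers:
  assumes E: "simple_graph E" and "star_union E"
  obtains Z where "star_centers E Z"
proof -
  obtain P where P: "partition_on UNIV P"
    and c0: "\<forall>B\<in>P. \<exists>c\<in>B. card B \<ge> 2 \<and> {e\<in>E. e \<subseteq> B} = {{c, x} | x. x \<in> B - {c}}"
    and "\<forall>e\<in>E. \<exists>B\<in>P. e \<subseteq> B"
    using assms unfolding star_union_def by (elim exE conjE)
  then have inB: "\<And>e. e \<in> E \<Longrightarrow> \<exists>B\<in>P. e \<subseteq> B" by simp
  obtain c where "\<forall>B\<in>P. c B \<in> B \<and> card B \<ge> 2 \<and> {e\<in>E. e \<subseteq> B} = {{c B, x} | x. x \<in> B - {c B}}"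
    using bchoice[OF c0[unfolded Bex_def]] by (elim exE)
  then have c: "\<And>B. B \<in> P \<Longrightarrow> c B \<in> B" "\<And>B. B \<in> P \<Longrightarrow> card B \<ge> 2"
    "\<And>B. B \<in> P \<Longrightarrow> {e\<in>E. e \<subseteq> B} = {{c B, x} | x. x \<in> B - {c B}}" by simp_all
  have uniq: "B = B'" if "x \<in> B" "x \<in> B'" "B \<in> P" "B' \<in> P" for x B B'
    using P that unfolding partition_on_def disjoint_def by blast
  have cx: "x = c B" if "x \<in> c ` P" "x \<in> B" "B \<in> P" for x B
    using that uniq c(1) by blast
  have all: "\<exists>B\<in>P. x \<in> B" for x using P unfolding partition_on_def by blast
  have edge: "{c B, x} \<in> E" if "B \<in> P" "x \<in> B" "x \<noteq> c B" for B x
    using c(3)[OF that(1)] that by blast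
  have "star_centers E (c ` P)"
    unfolding star_centers_def
  proof (intro conjI ballI allI impI)
    fix e assume "e \<in> E"
    then obtain B where B: "B \<in> P" "e \<subseteq> B" using inB by blast
    then obtain x where "x \<in> B - {c B}" "e = {c B, x}" using c(3)[OF B(1)] \<open>e \<in> E\<close> by blast
    then show "\<exists>z\<in>c ` P. \<exists>x. x \<notin> c ` P \<and> e = {z, x}" using B cx by blast
  next
    fix x assume x: "x \<notin> c ` P"
    obtain B where B: "B \<in> P" "x \<in> B" using all by blast
    show "\<exists>!z. {z, x} \<in> E"
    proof (rule ex1I[of _ "c B"])
      show "{c B, x} \<in> E" using edge B x by blast
      fix z assume zx: "{z, x} \<in> E"
      then obtain B' where B': "B' \<in> P" "{z, x} \<subseteq> B'" using inB by blast
      then have "B' = B" using uniq B by blast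
      then have "{z, x} \<in> {e\<in>E. e \<subseteq> B}" using zx B' by simp
      then have "\<exists>y. {z, x} = {c B, y}" unfolding c(3)[OF B(1)] by blast
      then show "z = c B" using x B by (auto simp: doubleton_eq_iff)
    qed
  next
    fix z assume "z \<in> c ` P"
    then obtain B where B: "B \<in> P" "z = c B" by blast
    have "B \<noteq> {c B}"
    proof
      assume "B = {c B}"
      then have "card B = 1" by (metis is_singletonI is_singleton_altdef)
      then show False using c(2)[OF B(1)] by simp
    qed
    then obtain x where "x \<in> B" "x \<noteq> c B" using c(1)[OF B(1)] by blast
    then show "\<exists>x. {z, x} \<in> E" using edge B by blast
  qed
  then show ?thesis using that by blast
qed

lemma star_centers_indep:
  assumes "star_centers E Z"
  shows "indep E Z" "indep E (- Z)"
proof -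
  have "\<exists>z\<in>Z. \<exists>x. x \<notin> Z \<and> e = {z, x}" if "e \<in> E" for e
    using assms that unfolding star_centers_def by simp
  then show "indep E Z" "indep E (- Z)" unfolding indep_def by fastforce+
qed

text \<open>Every star meets \<open>A\<close>: its edge \<open>{z, x}\<close> meets
  \<open>nbhd E A\<close>, so \<open>A\<close> contains a neighbour of \<open>z\<close> or a
  neighbour of the leaf \<open>x\<close>, and the latter can only be \<open>z\<close>. Distinct
  stars are disjoint, which gives an injection.\<close>

lemma star_centers_card_le:
  fixes E :: "('v::finite) set set"
  assumes Z: "star_centers E Z" and A: "cover_gen E A"
  shows "card Z \<le> card A"
proof -
  have leaf: "z = z'" if "{z, x} \<in> E" "{z', x} \<in> E" "x \<notin> Z" for x z z'
    using Z that unfolding star_centers_def by blast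
  have outside: "x \<notin> Z" if "{z, x} \<in> E" "z \<in> Z" for x z
    using star_centers_indep(1)[OF Z] indep_edge that by metis
  have "\<exists>a. a \<in> A \<and> (a = z \<or> {z, a} \<in> E)" if z: "z \<in> Z" for z
  proof -
    obtain x where x: "{z, x} \<in> E" using Z z unfolding star_centers_def by blast
    then have xZ: "x \<notin> Z" using outside z by blast
    have "\<forall>e\<in>E. e \<inter> nbhd E A \<noteq> {}" using A unfolding cover_gen_def by simp
    then have "{z, x} \<inter> nbhd E A \<noteq> {}" using x by (rule bspec)
    then consider a where "a \<in> A" "{a, z} \<in> E" | a where "a \<in> A" "{a, x} \<in> E"
      unfolding nbhd_def by blast
    then show ?thesis
    proof cases
      case 1 then show ?thesis by (auto simp: insert_commute)
    next
      case 2 then show ?thesis using leaf[OF x _ xZ] by blast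
    qed
  qed
  then obtain g where g: "\<And>z. z \<in> Z \<Longrightarrow> g z \<in> A \<and> (g z = z \<or> {z, g z} \<in> E)" by metis
  have "inj_on g Z"
  proof (rule inj_onI)
    fix z z' assume zz: "z \<in> Z" "z' \<in> Z" "g z = g z'"
    show "z = z'"
      using g[OF zz(1)] g[OF zz(2)] zz leaf outside by metis
  qed
  then show ?thesis using g by (intro card_inj_on_le[of g]) auto
qed

section \<open>The alternating count of independent sets\<close>

text \<open>Inserting or deleting \<open>l\<close> is a sign-reversing involution.\<close>

lemma sum_minus_one_power_toggle:
  fixes F :: "'v::finite set set"
  assumes "\<And>S. S \<in> F \<Longrightarrow> insert l S \<in> F" "\<And>S. S \<in> F \<Longrightarrow> S - {l} \<in> F"
  shows "(\<Sum>S\<in>F. (-1::int) ^ card S) = 0"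
proof -
  let ?A = "{S\<in>F. l \<in> S}" and ?B = "{S\<in>F. l \<notin> S}"
  have "(\<Sum>S\<in>F. (-1::int) ^ card S) = (\<Sum>S\<in>?A. (-1) ^ card S) + (\<Sum>S\<in>?B. (-1) ^ card S)"
    by (subst sum.union_disjoint[symmetric]) (auto intro!: sum.cong)
  also have "(\<Sum>S\<in>?A. (-1::int) ^ card S) = (\<Sum>S\<in>?B. (-1) ^ card (insert l S))"
    by (rule sum.reindex_bij_witness[of _ "insert l" "\<lambda>S. S - {l}"]) (use assms in \<open>auto simp: insert_absorb\<close>)
  also have "\<dots> = - (\<Sum>S\<in>?B. (-1) ^ card S)"
    by (simp add: sum_negf[symmetric])
  finally show ?thesis by simp
qed

text \<open>An isolated vertex can be toggled without affecting independence.\<close>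

lemma alternating_sum_isolated:
  fixes E :: "('v::finite) set set"
  assumes "\<And>e. e \<in> E \<Longrightarrow> x \<notin> e"
  shows "(\<Sum>S | indep E S. (-1::int) ^ card S) = 0"
  by (rule sum_minus_one_power_toggle[of _ x])
    (use assms in \<open>auto simp: indep_def subset_insert subset_Diff_insert\<close>)

lemma alternating_sum_star:
  fixes E :: "('v::finite) set set"
  assumes E: "simple_graph E" and Z: "star_centers E Z"
  shows "(\<Sum>S | indep E S. (-1::int) ^ card S) \<noteq> 0"
proof -
  \<comment> \<open>The centres are forced into the sets one at a time; the sets omitting the new
    centre \<open>z\<close> cancel among themselves.\<close>
  have step: "(\<Sum>S | indep E S. (-1::int) ^ card S) = (\<Sum>S | indep E S \<and> D \<subseteq> S. (-1) ^ card S)"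
    if "D \<subseteq> Z" for D
    using finite[of D] that
  proof (induction D)
    case (insert z D)
    let ?F = "{S. indep E S \<and> D \<subseteq> S \<and> z \<notin> S}"
    obtain l where l: "{z, l} \<in> E" using Z insert.prems unfolding star_centers_def by blast
    then have lZ: "l \<notin> Z" using star_centers_indep(1)[OF Z] indep_edge insert.prems by (metis insert_subset)
    have zl: "z \<noteq> l" using simple_graph_irrefl[OF E l] .
    have only: "e = {z, l}" if e: "e \<in> E" "l \<in> e" for e
    proof -
      obtain a b where ab: "e = {a, b}" "a \<noteq> b" using E e(1) by (rule simple_graph_edgeE)
      have u: "\<And>a. {a, l} \<in> E \<Longrightarrow> a = z" using Z lZ l unfolding star_centers_def by blast
      show ?thesis using u[of a] u[of b] ab e by (auto simp: insert_commute)
    qed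
    \<comment> \<open>The leaf \<open>l\<close> is free to enter or leave an independent set that avoids its only neighbour.\<close>
    have "(\<Sum>S\<in>?F. (-1::int) ^ card S) = 0"
    proof (rule sum_minus_one_power_toggle[of _ l])
      fix S assume S: "S \<in> ?F"
      show "insert l S \<in> ?F"
        using S only zl unfolding indep_def by auto
      \<comment> \<open>\<open>l\<close> is no centre, so removing it keeps
        \<open>D \<subseteq> S\<close>.\<close>
      show "S - {l} \<in> ?F"
        using S lZ insert.prems by (auto intro: indep_subset)
    qed
    moreover have "(\<Sum>S | indep E S \<and> D \<subseteq> S. (-1::int) ^ card S) =
       (\<Sum>S | indep E S \<and> insert z D \<subseteq> S. (-1) ^ card S) + (\<Sum>S\<in>?F. (-1) ^ card S)"
      by (subst sum.union_disjoint[symmetric]) (auto intro!: sum.cong)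
    ultimately show ?case using insert by simp
  qed simp
  \<comment> \<open>A set containing all centres has no room for a leaf, so a single term of the sum
    remains.\<close>
  have "{S. indep E S \<and> Z \<subseteq> S} = {Z}"
  proof -
    have "x \<in> Z" if "indep E S" "Z \<subseteq> S" "x \<in> S" for S x
    proof (rule ccontr)
      assume x: "x \<notin> Z"
      then obtain z where zx: "{z, x} \<in> E" using Z unfolding star_centers_def by blast
      then have "z \<in> Z" using indep_edge[OF star_centers_indep(2)[OF Z] zx] x by auto
      then show False using indep_edge[OF \<open>indep E S\<close> zx] that by blast
    qed
    then show ?thesis using star_centers_indep(1)[OF Z] by blast
  qed
  with step[of Z] show ?thesis by simp
qed

section \<open>Independent sets generating a vertex cover\<close>

text \<open>Every edge has an end outside \<open>S\<close>, and \<open>f\<close> makes each such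
  vertex a neighbour of the image.\<close>

lemma cover_gen_image:
  assumes E: "simple_graph E" and S: "indep E S"
    and f: "\<And>c. c \<notin> S \<Longrightarrow> f c \<in> S \<and> {f c, c} \<in> E"
  shows "cover_gen E (f ` (- S))"
proof -
  have "- S \<subseteq> nbhd E (f ` (- S))" using f unfolding nbhd_def by auto
  moreover have "f ` (- S) \<subseteq> S" using f by auto
  ultimately show ?thesis using S indep_subset[OF S] unfolding cover_gen_def indep_def by blast
qed

lemma star_centers_if_no_small_cover_gen:
  fixes E :: "('v::finite) set set"
  assumes E: "simple_graph E" and S: "indep E S"
    and max: "\<And>x. x \<notin> S \<Longrightarrow> \<not> indep E (insert x S)"
    and no_isolated: "\<And>x. \<exists>e\<in>E. x \<in> e"
    and no_small: "\<And>A. cover_gen E A \<Longrightarrow> card (- S) \<le> card A"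
  shows "star_centers E (- S)"
proof -
  have nb: "\<exists>y. {y, x} \<in> E" for x
  proof -
    obtain e where e: "e \<in> E" "x \<in> e" using no_isolated by blast
    obtain a b where "a \<noteq> b" "e = {a, b}" using E e(1) by (rule simple_graph_edgeE)
    then show ?thesis using e by (auto simp: insert_commute)
  qed
  obtain f where f: "\<And>c. c \<notin> S \<Longrightarrow> f c \<in> S \<and> {f c, c} \<in> E"
    using not_indep_insert[OF E S max] unfolding nbhd_def mem_Collect_eq Bex_def by metis
  have leaf: "c = c'" if s: "s \<in> S" and c: "{c, s} \<in> E" "{c', s} \<in> E" for s c c'
  proof (rule ccontr)
    assume ne: "c \<noteq> c'"
    have cS: "c \<notin> S" "c' \<notin> S" using indep_edge[OF S _ s] c by (auto simp: insert_commute)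
    \<comment> \<open>Sending both \<open>c\<close> and \<open>c'\<close> to \<open>s\<close> is an
      equally valid choice of neighbours, but it is not injective, so its image would be smaller
      than \<open>- S\<close>.\<close>
    define g where "g = f(c := s, c' := s)"
    have "cover_gen E (g ` (- S))"
      by (rule cover_gen_image[OF E S]) (use f c s in \<open>auto simp: g_def insert_commute\<close>)
    then have "card (- S) \<le> card (g ` (- S))" by (rule no_small)
    then have "inj_on g (- S)" by (simp add: eq_card_imp_inj_on card_image_le le_antisym)
    moreover have "g c = g c'" by (simp add: g_def)
    ultimately have "c = c'" using cS by (simp add: inj_on_def)
    then show False using ne by simp
  qed
  have "indep E (- S)"
  proof (rule ccontr)
    assume "\<not> indep E (- S)"
    then obtain e where e: "e \<in> E" "e \<subseteq> - S" unfolding indep_def by blast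
    obtain c c' where c: "c \<noteq> c'" "e = {c, c'}" using E e(1) by (rule simple_graph_edgeE)
    have "\<not> e \<subseteq> {c}" if "e \<in> E" for e
      by (rule simple_graph_edgeE[OF E that]) auto
    then have "indep E {c}" unfolding indep_def by simp
    \<comment> \<open>Maximality makes \<open>B\<close> a cover generator, while the edge from
      \<open>c\<close> to \<open>c'\<close> keeps \<open>c'\<close> out of \<open>B\<close>, so
      \<open>B\<close> is smaller than \<open>- S\<close>.\<close>
    then obtain B where B: "{c} \<subseteq> B" "B \<subseteq> - S" "indep E B"
      and Bmax: "\<And>x. x \<in> - S - B \<Longrightarrow> \<not> indep E (insert x B)"
      using maximal_indep_extension[of E "{c}" "- S"] e c by auto
    \<comment> \<open>An end of the edge outside \<open>S\<close> is either in \<open>B\<close>,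
      which puts the other end into \<open>nbhd E B\<close>, or is itself in \<open>nbhd E B\<close>
      by maximality.\<close>
    have "e' \<inter> nbhd E B \<noteq> {}" if e': "e' \<in> E" for e'
    proof -
      obtain x y where xy: "x \<noteq> y" "e' = {x, y}" using E e' by (rule simple_graph_edgeE)
      have "x \<notin> S \<or> y \<notin> S" using indep_edge[OF S, of x y] e' xy(2) by auto
      then consider "x \<in> B" | "y \<in> B" | "x \<in> - S - B" | "y \<in> - S - B" by auto
      then show ?thesis
      proof cases
        case 1 then show ?thesis using nbhdI[of x y E B] xy e' by simp
      next
        case 2 then show ?thesis using nbhdI'[of x y E B] xy e' by simp
      next
        case 3 then show ?thesis using not_indep_insert[OF E B(3) Bmax] xy by simp
      next
        case 4 then show ?thesis using not_indep_insert[OF E B(3) Bmax] xy by simp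
      qed
    qed
    then have "cover_gen E B" using B unfolding cover_gen_def by blast
    then have "card (- S) \<le> card B" by (rule no_small)
    moreover have "c' \<notin> B" using indep_edge[OF B(3), of c c'] e c B(1) by auto
    then have "B \<subset> - S" using B e c by blast
    then have "card B < card (- S)" by (intro psubset_card_mono) auto
    ultimately show False by simp
  qed
  then show ?thesis
    unfolding star_centers_def
  proof (intro conjI ballI allI impI)
    fix e assume e: "e \<in> E"
    obtain a b where ab: "a \<noteq> b" "e = {a, b}" using E e by (rule simple_graph_edgeE)
    then show "\<exists>z\<in>- S. \<exists>x. x \<notin> - S \<and> e = {z, x}"
      using e S \<open>indep E (- S)\<close> indep_edge[of E S a b] indep_edge[of E "- S" a b]
      by (cases "a \<in> S") (auto simp: insert_commute)
  next
    fix x assume "x \<notin> - S"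
    then show "\<exists>!z. {z, x} \<in> E" using nb[of x] leaf[of x] by blast
  next
    fix z assume "z \<in> - S"
    then show "\<exists>x. {z, x} \<in> E" using nb[of z] by (auto simp: insert_commute)
  qed
qed

section \<open>Monomial membership criteria\<close>

definition expo :: "'v set \<Rightarrow> 'v \<Rightarrow>\<^sub>0 nat" where
  "expo S = (\<Sum>v\<in>S. Poly_Mapping.single v 1)"

text \<open>For upward closed \<open>Q\<close> this is a squarefree monomial ideal. Edge ideals and
  ideals generated by variables both have this form, so membership is tested on the supports of
  single monomials.\<close>

definition supp_ideal :: "('v set \<Rightarrow> bool) \<Rightarrow> ('v, 'k::zero) mpoly set" where
  "supp_ideal Q = {f. \<forall>m\<in>Poly_Mapping.keys f. Q (Poly_Mapping.keys m)}"

lemma lookup_expo: "finite S \<Longrightarrow> Poly_Mapping.lookup (expo S) v = (if v \<in> S then 1 else 0)"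
  by (simp add: expo_def lookup_sum lookup_single when_def)

lemma edge_mon_expo: "edge_mon e = Poly_Mapping.single (expo e) 1"
  by (simp add: edge_mon_def expo_def)

lemma keys_expo: "finite S \<Longrightarrow> Poly_Mapping.keys (expo S) = S"
  by (auto simp: in_keys_iff lookup_expo split: if_splits)

lemma mon_deg_expo: "finite S \<Longrightarrow> mon_deg (expo S) = card S"
  by (simp add: mon_deg_def keys_expo lookup_expo)

lemma keys_add_nat:
  "Poly_Mapping.keys (m + m' :: 'v \<Rightarrow>\<^sub>0 nat) = Poly_Mapping.keys m \<union> Poly_Mapping.keys m'"
  by (auto simp: in_keys_iff lookup_add)

lemma sum_single_lookup:
  "(\<Sum>m\<in>Poly_Mapping.keys f. Poly_Mapping.single m (Poly_Mapping.lookup f m)) = f"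
  by (rule poly_mapping_eqI) (auto simp: lookup_sum lookup_single when_def in_keys_iff)

text \<open>Multiplication by a monomial shifts exponents injectively, so no terms merge.\<close>

lemma lookup_mult_single:
  fixes g :: "('v, 'k::comm_ring_1) mpoly"
  shows "Poly_Mapping.lookup (g * Poly_Mapping.single s c) (m + s) = Poly_Mapping.lookup g m * c"
proof -
  have "g * Poly_Mapping.single s c =
      (\<Sum>a\<in>Poly_Mapping.keys g. Poly_Mapping.single (a + s) (Poly_Mapping.lookup g a * c))"
    by (subst sum_single_lookup[of g, symmetric]) (simp add: sum_distrib_right mult_single)
  then show ?thesis by (auto simp: lookup_sum lookup_single when_def in_keys_iff)
qed

lemma keys_mult_single:
  fixes g :: "('v, 'k::comm_ring_1) mpoly"
  shows "Poly_Mapping.keys (g * Poly_Mapping.single s 1) = (\<lambda>m. m + s) ` Poly_Mapping.keys g"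
proof (intro equalityI subsetI)
  fix x assume "x \<in> Poly_Mapping.keys (g * Poly_Mapping.single s 1)"
  then show "x \<in> (\<lambda>m. m + s) ` Poly_Mapping.keys g" using keys_mult[of g "Poly_Mapping.single s 1"] by auto
next
  fix x assume "x \<in> (\<lambda>m. m + s) ` Poly_Mapping.keys g"
  then show "x \<in> Poly_Mapping.keys (g * Poly_Mapping.single s 1)"
    using lookup_mult_single[of g s 1] by (auto simp: in_keys_iff)
qed

text \<open>Multiplying monomials unites their supports, hence the assumption that \<open>Q\<close>
  is upward closed.\<close>

lemma is_ideal_supp_ideal:
  assumes "\<And>S T. Q S \<Longrightarrow> S \<subseteq> T \<Longrightarrow> Q T"
  shows "is_ideal (supp_ideal Q :: ('v, 'k::comm_ring_1) mpoly set)"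
  unfolding is_ideal_def
proof (intro conjI ballI allI)
  show "0 \<in> (supp_ideal Q :: ('v, 'k) mpoly set)" by (simp add: supp_ideal_def)
next
  fix a b :: "('v, 'k) mpoly" assume "a \<in> supp_ideal Q" "b \<in> supp_ideal Q"
  then show "a + b \<in> supp_ideal Q" using Poly_Mapping.keys_add[of a b] by (auto simp: supp_ideal_def)
next
  fix a r :: "('v, 'k) mpoly" assume a: "a \<in> supp_ideal Q"
  have "Q (Poly_Mapping.keys m)" if "m \<in> Poly_Mapping.keys (r * a)" for m
  proof -
    obtain x y where "y \<in> Poly_Mapping.keys a" "m = x + y" using keys_mult[of r a] \<open>m \<in> _\<close> by blast
    then show ?thesis using a assms[of "Poly_Mapping.keys y"] by (auto simp: supp_ideal_def keys_add_nat)
  qed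
  then show "r * a \<in> supp_ideal Q" by (simp add: supp_ideal_def)
qed

lemma edge_ideal_eq_supp_ideal:
  fixes E :: "('v::finite) set set"
  shows "(edge_ideal E :: ('v, 'k::comm_ring_1) mpoly set) = supp_ideal (\<lambda>S. \<not> indep E S)"
proof (intro equalityI subsetI)
  fix f :: "('v, 'k) mpoly" assume "f \<in> edge_ideal E"
  then obtain c where f: "f = (\<Sum>e\<in>E. c e * edge_mon e)" unfolding edge_ideal_def by blast
  have "\<not> indep E (Poly_Mapping.keys m)" if "m \<in> Poly_Mapping.keys f" for m
  proof -
    obtain e where e: "e \<in> E" "m \<in> Poly_Mapping.keys (c e * edge_mon e)"
      using \<open>m \<in> _\<close> Poly_Mapping.keys_sum[of "\<lambda>e. c e * edge_mon e" E] unfolding f by blast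
    then show ?thesis
      unfolding edge_mon_expo keys_mult_single indep_def by (auto simp: keys_add_nat keys_expo)
  qed
  then show "f \<in> supp_ideal (\<lambda>S. \<not> indep E S)" by (simp add: supp_ideal_def)
next
  fix f :: "('v, 'k) mpoly" assume f: "f \<in> supp_ideal (\<lambda>S. \<not> indep E S)"
  have "\<forall>m\<in>Poly_Mapping.keys f. \<exists>e. e \<in> E \<and> e \<subseteq> Poly_Mapping.keys m"
    using f unfolding supp_ideal_def indep_def by blast
  from bchoice[OF this] obtain e where e: "\<And>m. m \<in> Poly_Mapping.keys f \<Longrightarrow> e m \<in> E \<and> e m \<subseteq> Poly_Mapping.keys m"
    by blast
  \<comment> \<open>Each monomial \<open>m\<close> has been assigned one edge \<open>e m\<close> in
    its support; \<open>c e'\<close> collects the terms assigned to \<open>e'\<close>, divided by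
    the edge monomial.\<close>
  define c where "c e' = (\<Sum>m\<in>{m\<in>Poly_Mapping.keys f. e m = e'}.
    Poly_Mapping.single (m - expo e') (Poly_Mapping.lookup f m))" for e'
  have split: "Poly_Mapping.single (m - expo (e m)) a * edge_mon (e m) = Poly_Mapping.single m a"
    if "m \<in> Poly_Mapping.keys f" for m and a :: 'k
  proof -
    \<comment> \<open>The truncated subtraction is exact because \<open>e m\<close> lies in the
      support of \<open>m\<close>.\<close>
    have "m - expo (e m) + expo (e m) = m"
      using e[OF that] by (intro poly_mapping_eqI) (auto simp: lookup_add lookup_minus lookup_expo in_keys_iff)
    then show ?thesis by (simp add: edge_mon_expo mult_single)
  qed
  have "(\<Sum>e'\<in>E. c e' * edge_mon e') =
      (\<Sum>e'\<in>E. \<Sum>m\<in>{m\<in>Poly_Mapping.keys f. e m = e'}. Poly_Mapping.single m (Poly_Mapping.lookup f m))"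
    unfolding c_def sum_distrib_right by (intro sum.cong refl) (use split in auto)
  also have "\<dots> = f"
    using e by (subst sum.group) (auto simp: sum_single_lookup)
  finally show "f \<in> edge_ideal E" unfolding edge_ideal_def by (intro CollectI exI[of _ c]) simp
qed

section \<open>Primality of ideals generated by variables\<close>

text \<open>Monomials over an arbitrary finite index type carry no term order; \<open>mon_code\<close> embeds them
  additively into \<open>nat \<Rightarrow>\<^sub>0 nat\<close>, which is linearly ordered compatibly with addition.\<close>

definition mon_code :: "('v::finite \<Rightarrow>\<^sub>0 nat) \<Rightarrow> (nat \<Rightarrow>\<^sub>0 nat)" where
  "mon_code m = (\<Sum>v\<in>UNIV. Poly_Mapping.single (to_nat_on UNIV v) (Poly_Mapping.lookup m v))"

lemma mon_code_add: "mon_code (a + b) = mon_code a + mon_code b"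
  by (simp add: mon_code_def lookup_add single_add sum.distrib)

lemma inj_mon_code: "inj (mon_code :: ('v::finite \<Rightarrow>\<^sub>0 nat) \<Rightarrow> _)"
proof (rule injI)
  fix a b :: "'v \<Rightarrow>\<^sub>0 nat" assume eq: "mon_code a = mon_code b"
  have inj: "to_nat_on UNIV v = to_nat_on UNIV w \<longleftrightarrow> v = w" for v w :: 'v
    by (simp add: countable_finite)
  have "Poly_Mapping.lookup (mon_code m) (to_nat_on UNIV v) = Poly_Mapping.lookup m v" for m and v :: 'v
    by (simp add: mon_code_def lookup_sum lookup_single when_def inj)
  then show "a = b" using eq by (intro poly_mapping_eqI) metis
qed

text \<open>Take the leading monomials with respect to \<open>mon_code\<close>: an equal sum forces
  both codes to be maximal. In a product this yields a coefficient with a single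
  contribution.\<close>

lemma unique_sum_exists:
  fixes M N :: "('v::finite \<Rightarrow>\<^sub>0 nat) set"
  assumes "finite M" "finite N" "M \<noteq> {}" "N \<noteq> {}"
  obtains a b where "a \<in> M" "b \<in> N"
    "\<And>a' b'. a' \<in> M \<Longrightarrow> b' \<in> N \<Longrightarrow> a' + b' = a + b \<Longrightarrow> a' = a \<and> b' = b"
proof -
  have top: "\<exists>a\<in>M. \<forall>a'\<in>M. mon_code a' \<le> mon_code a"
    if "finite M" "M \<noteq> {}" for M :: "('v::finite \<Rightarrow>\<^sub>0 nat) set"
  proof -
    have "Max (mon_code ` M) \<in> mon_code ` M" using that by (intro Max_in) auto
    then show ?thesis using that by (metis (no_types, lifting) Max_ge finite_imageI image_iff)
  qed
  obtain a where a: "a \<in> M" "\<And>a'. a' \<in> M \<Longrightarrow> mon_code a' \<le> mon_code a"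
    using top[OF assms(1,3)] by blast
  obtain b where b: "b \<in> N" "\<And>b'. b' \<in> N \<Longrightarrow> mon_code b' \<le> mon_code b"
    using top[OF assms(2,4)] by blast
  have "a' = a \<and> b' = b" if "a' \<in> M" "b' \<in> N" "a' + b' = a + b" for a' b'
  proof -
    have "mon_code a' + mon_code b' = mon_code a + mon_code b"
      using that(3) by (metis mon_code_add)
    then have "mon_code a' = mon_code a"
      using a(2)[OF that(1)] b(2)[OF that(2)] by (metis add_less_le_mono order_le_less order_less_irrefl)
    then have "a' = a" by (rule injD[OF inj_mon_code])
    then show ?thesis using that(3) by simp
  qed
  then show ?thesis using that a(1) b(1) by blast
qed

lemma mult_eq_double_sum:
  fixes f g :: "('v, 'k::comm_ring_1) mpoly"
  shows "f * g = (\<Sum>(a, b)\<in>Poly_Mapping.keys f \<times> Poly_Mapping.keys g.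
    Poly_Mapping.single (a + b) (Poly_Mapping.lookup f a * Poly_Mapping.lookup g b))"
proof -
  have "f * g = (\<Sum>a\<in>Poly_Mapping.keys f. Poly_Mapping.single a (Poly_Mapping.lookup f a)) *
      (\<Sum>b\<in>Poly_Mapping.keys g. Poly_Mapping.single b (Poly_Mapping.lookup g b))"
    by (simp only: sum_single_lookup)
  then show ?thesis by (simp add: sum_product sum.cartesian_product mult_single)
qed

text \<open>Discard the monomials involving \<open>C\<close>. The leading terms of what remains of
  \<open>f\<close> and \<open>g\<close> multiply to a term of \<open>f * g\<close> that avoids
  \<open>C\<close> and is not cancelled.\<close>

lemma is_prime_ideal_variables:
  fixes C :: "('v::finite) set"
  shows "is_prime_ideal (supp_ideal (\<lambda>S. S \<inter> C \<noteq> {}) :: ('v, 'k::field) mpoly set)"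
    (is "is_prime_ideal ?P")
  unfolding is_prime_ideal_def
proof (intro conjI allI impI)
  show "is_ideal ?P" by (rule is_ideal_supp_ideal) auto
  have "1 \<notin> ?P" by (simp add: supp_ideal_def)
  then show "?P \<noteq> UNIV" by blast
next
  fix f g :: "('v, 'k) mpoly" assume fg: "f * g \<in> ?P"
  show "f \<in> ?P \<or> g \<in> ?P"
  proof (rule ccontr)
    assume "\<not> ?thesis"
    then have ne: "{m\<in>Poly_Mapping.keys f. Poly_Mapping.keys m \<inter> C = {}} \<noteq> {}" (is "?M \<noteq> {}")
      "{m\<in>Poly_Mapping.keys g. Poly_Mapping.keys m \<inter> C = {}} \<noteq> {}" (is "?N \<noteq> {}")
      by (auto simp: supp_ideal_def)
    obtain a b where ab: "a \<in> ?M" "b \<in> ?N"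
      and uniq: "\<And>a' b'. a' \<in> ?M \<Longrightarrow> b' \<in> ?N \<Longrightarrow> a' + b' = a + b \<Longrightarrow> a' = a \<and> b' = b"
      by (rule unique_sum_exists[OF _ _ ne]) auto
    have avoid: "Poly_Mapping.keys (a + b) \<inter> C = {}" using ab by (auto simp: keys_add_nat)
    have iff: "x + y = a + b \<longleftrightarrow> (x, y) = (a, b)"
      if "x \<in> Poly_Mapping.keys f" "y \<in> Poly_Mapping.keys g" for x y
    proof
      assume eq: "x + y = a + b"
      \<comment> \<open>The comparison runs over all terms of \<open>f\<close> and \<open>g\<close>;
        a factor of a monomial avoiding \<open>C\<close> avoids \<open>C\<close> too, so discarded
        terms cannot interfere.\<close>
      have "Poly_Mapping.keys x \<inter> C = {}" "Poly_Mapping.keys y \<inter> C = {}"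
        using avoid unfolding eq[symmetric] keys_add_nat by blast+
      then show "(x, y) = (a, b)" using uniq[of x y] that eq by simp
    qed simp
    have "Poly_Mapping.lookup (f * g) (a + b) =
        (\<Sum>p\<in>Poly_Mapping.keys f \<times> Poly_Mapping.keys g.
          if p = (a, b) then Poly_Mapping.lookup f a * Poly_Mapping.lookup g b else 0)"
      unfolding mult_eq_double_sum[of f g] lookup_sum
      by (intro sum.cong refl) (use iff in \<open>auto simp: lookup_single when_def split: if_splits\<close>)
    also have "\<dots> = Poly_Mapping.lookup f a * Poly_Mapping.lookup g b" using ab by simp
    also have "\<dots> \<noteq> 0" using ab by (simp add: in_keys_iff)
    finally have "a + b \<in> Poly_Mapping.keys (f * g)" by (simp add: in_keys_iff)
    then show False using fg avoid unfolding supp_ideal_def by blast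
  qed
qed

section \<open>The v-number\<close>

lemma homog_single: "Poly_Mapping.single m c \<in> homog (mon_deg m)"
  by (auto simp: homog_def)

text \<open>Multiplication by this monomial adds \<open>A\<close> to every support, and
  \<open>indep_Un_iff\<close> tells when the result contains an edge.\<close>

lemma colon_edge_ideal_expo:
  fixes E :: "('v::finite) set set"
  assumes E: "simple_graph E" and A: "cover_gen E A"
  shows "colon (edge_ideal E) (Poly_Mapping.single (expo A) 1) =
    (supp_ideal (\<lambda>S. S \<inter> nbhd E A \<noteq> {}) :: ('v, 'k::field) mpoly set)"
  using indep_Un_iff[OF E A]
  by (auto simp: colon_def edge_ideal_eq_supp_ideal supp_ideal_def keys_mult_single keys_add_nat keys_expo)

text \<open>Stated as the predicate minimised in \<open>v_number\<close>, so that it gives both the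
  upper bound and the attainment of the minimum.\<close>

lemma v_number_witness:
  fixes E :: "('v::finite) set set"
  assumes E: "simple_graph E" and A: "cover_gen E A"
  shows "\<exists>f\<in>homog (card A). \<exists>P\<in>Ass (edge_ideal E :: ('v, 'k::field) mpoly set). colon (edge_ideal E) f = P"
proof -
  let ?f = "Poly_Mapping.single (expo A) 1 :: ('v, 'k) mpoly"
  have "?f \<in> homog (card A)" using homog_single[of "expo A" "1::'k"] by (simp add: mon_deg_expo)
  moreover have "colon (edge_ideal E) ?f \<in> Ass (edge_ideal E)"
    using is_prime_ideal_variables[of "nbhd E A"] unfolding Ass_def colon_edge_ideal_expo[OF E A, symmetric] by blast
  ultimately show ?thesis by blast
qed

lemma v_number_le_card:
  fixes E :: "('v::finite) set set"
  assumes "simple_graph E" "cover_gen E A"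
  shows "v_number (edge_ideal E :: ('v, 'k::field) mpoly set) \<le> card A"
  unfolding v_number_def by (rule Least_le, rule v_number_witness[OF assms])

text \<open>\<open>A0\<close> guarantees that the minimum is attained. The minimiser
  \<open>f\<close> need not be a monomial, but any of its monomials outside the edge ideal has a
  suitable support, whose size is at most the degree.\<close>

lemma v_number_cover_gen:
  fixes E :: "('v::finite) set set"
  assumes E: "simple_graph E" and A0: "cover_gen E A0"
  obtains A where "cover_gen E A" "card A \<le> v_number (edge_ideal E :: ('v, 'k::field) mpoly set)"
proof -
  let ?I = "edge_ideal E :: ('v, 'k) mpoly set"
  have ideal: "is_ideal ?I" unfolding edge_ideal_eq_supp_ideal
    by (rule is_ideal_supp_ideal) (auto intro: indep_subset)
  have "\<exists>f\<in>homog (v_number ?I). \<exists>P\<in>Ass ?I. colon ?I f = P"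
    unfolding v_number_def by (rule LeastI, rule v_number_witness[OF E A0])
  then obtain f where f: "f \<in> homog (v_number ?I)" and "colon ?I f \<in> Ass ?I" by blast
  then have prime: "is_prime_ideal (colon ?I f)" by (simp add: Ass_def)
  \<comment> \<open>Otherwise the colon ideal would be the whole ring.\<close>
  have "f \<notin> ?I"
    using prime ideal unfolding is_prime_ideal_def is_ideal_def colon_def by blast
  then obtain m where m: "m \<in> Poly_Mapping.keys f" "indep E (Poly_Mapping.keys m)"
    unfolding edge_ideal_eq_supp_ideal supp_ideal_def by blast
  \<comment> \<open>A monomial ideal contains a polynomial only together with all its terms, so the
    product of \<open>m\<close> and the variable \<open>v\<close> lies in the ideal as well.\<close>
  have nb: "v \<in> nbhd E (Poly_Mapping.keys m)"
    if "Poly_Mapping.single (Poly_Mapping.single v 1) 1 \<in> colon ?I f" for v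
  proof -
    have "f * Poly_Mapping.single (Poly_Mapping.single v 1) 1 \<in> ?I"
      using that unfolding colon_def by (simp add: mult.commute)
    then have "\<forall>m\<in>Poly_Mapping.keys f. \<not> indep E (Poly_Mapping.keys (m + Poly_Mapping.single v 1))"
      by (simp add: edge_ideal_eq_supp_ideal supp_ideal_def keys_mult_single)
    then have "\<not> indep E (Poly_Mapping.keys (m + Poly_Mapping.single v 1))" using m(1) by (rule bspec)
    then have "\<not> indep E (insert v (Poly_Mapping.keys m))" by (simp add: keys_add_nat)
    then show ?thesis by (rule not_indep_insert[OF E m(2)])
  qed
  \<comment> \<open>The edge monomial multiplies \<open>f\<close> into the ideal, so primality puts
    the variable of one end into the colon ideal.\<close>
  have "e \<inter> nbhd E (Poly_Mapping.keys m) \<noteq> {}" if e: "e \<in> E" for e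
  proof -
    obtain a b where ab: "a \<noteq> b" "e = {a, b}" using E e by (rule simple_graph_edgeE)
    have "(edge_mon e :: ('v, 'k) mpoly) \<in> ?I"
      using e unfolding edge_ideal_eq_supp_ideal supp_ideal_def indep_def edge_mon_expo
      by (auto simp: keys_expo)
    then have "f * edge_mon e \<in> ?I" using ideal unfolding is_ideal_def by blast
    moreover have "(edge_mon e :: ('v, 'k) mpoly) =
        Poly_Mapping.single (Poly_Mapping.single a 1) 1 * Poly_Mapping.single (Poly_Mapping.single b 1) 1"
      using ab by (simp add: edge_mon_def mult_single)
    ultimately have "Poly_Mapping.single (Poly_Mapping.single a 1) 1 *
        Poly_Mapping.single (Poly_Mapping.single b 1) 1 \<in> colon ?I f"
      unfolding colon_def by (simp add: mult.commute)
    then have "Poly_Mapping.single (Poly_Mapping.single a 1) 1 \<in> colon ?I f \<or>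
        Poly_Mapping.single (Poly_Mapping.single b 1) 1 \<in> colon ?I f"
      using prime unfolding is_prime_ideal_def by blast
    then show ?thesis using nb ab by blast
  qed
  then have "cover_gen E (Poly_Mapping.keys m)" using m(2) unfolding cover_gen_def by blast
  moreover have "card (Poly_Mapping.keys m) \<le> v_number ?I"
  proof -
    have "card (Poly_Mapping.keys m) = (\<Sum>v\<in>Poly_Mapping.keys m. 1)" by simp
    also have "\<dots> \<le> mon_deg m" unfolding mon_deg_def by (rule sum_mono) (simp add: in_keys_iff)
    also have "\<dots> = v_number ?I" using f m(1) unfolding homog_def by blast
    finally show ?thesis .
  qed
  ultimately show ?thesis by (rule that)
qed

section \<open>The Hilbert series\<close>

lemma lookup_kscale: "Poly_Mapping.lookup (kscale c p) m = c * Poly_Mapping.lookup p m"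
  using lookup_mult_single[of p 0 c m] by (simp add: kscale_def mult.commute)

lemma vector_space_kscale: "vector_space (kscale :: 'k::field \<Rightarrow> ('v, 'k) mpoly \<Rightarrow> _)"
  by unfold_locales
    (rule poly_mapping_eqI, simp add: lookup_kscale lookup_add distrib_left distrib_right mult.assoc)+

text \<open>The monomials in \<open>M\<close> form a basis. Both \<open>homog d\<close> and its
  intersection with a monomial ideal have this shape.\<close>

lemma dim_monomial_span:
  fixes M :: "('v \<Rightarrow>\<^sub>0 nat) set"
  assumes "finite M"
  shows "vector_space.dim (kscale :: 'k::field \<Rightarrow> _) {f :: ('v, 'k) mpoly. Poly_Mapping.keys f \<subseteq> M} = card M"
proof -
  interpret vs: vector_space "kscale :: 'k \<Rightarrow> ('v, 'k) mpoly \<Rightarrow> _" by (rule vector_space_kscale)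
  define mon where "mon m = (Poly_Mapping.single m 1 :: ('v, 'k) mpoly)" for m :: "'v \<Rightarrow>\<^sub>0 nat"
  have lookup_mon: "Poly_Mapping.lookup (mon m') m = (if m' = m then 1 else 0)" for m m'
    by (simp add: mon_def lookup_single when_def)
  have inj: "inj_on mon M"
    by (intro inj_onI) (metis lookup_mon zero_neq_one)
  show ?thesis
  proof (rule vs.dim_unique)
    show "mon ` M \<subseteq> {f. Poly_Mapping.keys f \<subseteq> M}" by (auto simp: mon_def)
    show "card (mon ` M) = card M" by (rule card_image[OF inj])
    show "vs.independent (mon ` M)"
    proof (rule vs.independent_if_scalars_zero)
      fix u x assume sum: "(\<Sum>x\<in>mon ` M. kscale (u x) x) = 0" and "x \<in> mon ` M"
      then obtain m where m: "m \<in> M" "x = mon m" by blast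
      have "0 = Poly_Mapping.lookup (\<Sum>m'\<in>M. kscale (u (mon m')) (mon m')) m"
        using sum by (simp add: sum.reindex[OF inj])
      also have "\<dots> = (\<Sum>m'\<in>M. if m' = m then u (mon m') else 0)"
        unfolding lookup_sum lookup_kscale lookup_mon by (intro sum.cong) auto
      also have "\<dots> = u x" using assms m by simp
      finally show "u x = 0" by simp
    qed (use assms in simp)
    show "{f. Poly_Mapping.keys f \<subseteq> M} \<subseteq> vs.span (mon ` M)"
    proof
      fix f :: "('v, 'k) mpoly" assume f: "f \<in> {f. Poly_Mapping.keys f \<subseteq> M}"
      have "kscale a (mon m) = Poly_Mapping.single m a" for a m
        by (simp add: kscale_def mon_def mult_single)
      then have "f = (\<Sum>m\<in>Poly_Mapping.keys f. kscale (Poly_Mapping.lookup f m) (mon m))"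
        using sum_single_lookup[of f] by simp
      also have "\<dots> \<in> vs.span (mon ` M)"
        using f by (intro vs.span_sum vs.span_scale vs.span_base) auto
      finally show "f \<in> vs.span (mon ` M)" .
    qed
  qed
qed

section \<open>Counting monomials by degree and support\<close>

lemma mon_deg_UNIV: "mon_deg (m :: ('v::finite) \<Rightarrow>\<^sub>0 nat) = (\<Sum>v\<in>UNIV. Poly_Mapping.lookup m v)"
  unfolding mon_deg_def by (rule sum.mono_neutral_left) (auto simp: in_keys_iff)

lemma mon_deg_add: "mon_deg (m + m' :: ('v::finite) \<Rightarrow>\<^sub>0 nat) = mon_deg m + mon_deg m'"
  by (simp add: mon_deg_UNIV lookup_add sum.distrib)

lemma mon_deg_single: "mon_deg (Poly_Mapping.single v c) = c"
  by (simp add: mon_deg_def)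

lemma finite_mon_deg: "finite {m :: ('v::finite) \<Rightarrow>\<^sub>0 nat. mon_deg m = d}"
proof (rule finite_imageD)
  have "Poly_Mapping.lookup m v \<le> mon_deg m" for m :: "'v \<Rightarrow>\<^sub>0 nat" and v
    unfolding mon_deg_UNIV by (rule member_le_sum) auto
  then have "Poly_Mapping.lookup ` {m :: 'v \<Rightarrow>\<^sub>0 nat. mon_deg m = d} \<subseteq> PiE UNIV (\<lambda>_. {..d})"
    by auto
  then show "finite (Poly_Mapping.lookup ` {m :: 'v \<Rightarrow>\<^sub>0 nat. mon_deg m = d})"
    by (rule finite_subset) (simp add: finite_PiE)
qed (rule inj_onI, rule poly_mapping_eqI, simp)

text \<open>Prescribing the support exactly makes the monomials outside the edge ideal split
  disjointly over the independent sets.\<close>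

definition mons :: "'v set \<Rightarrow> nat \<Rightarrow> ('v \<Rightarrow>\<^sub>0 nat) set" where
  "mons S d = {m. Poly_Mapping.keys m = S \<and> mon_deg m = d}"

lemma finite_mons [simp]: "finite (mons S d :: (('v::finite) \<Rightarrow>\<^sub>0 nat) set)"
  by (rule finite_subset[OF _ finite_mon_deg[of d]]) (auto simp: mons_def)

lemma mons_empty: "mons {} d = (if d = 0 then {0} else {})"
  by (auto simp: mons_def mon_deg_def)

lemma mons_insert_0: "mons (insert v S :: ('v::finite) set) 0 = {}"
proof -
  have "v \<notin> Poly_Mapping.keys m" if "mon_deg m = 0" for m :: "'v \<Rightarrow>\<^sub>0 nat"
    using that by (simp add: mon_deg_UNIV in_keys_iff)
  then show ?thesis by (auto simp: mons_def)
qed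

text \<open>Dividing by the variable \<open>v\<close> either removes \<open>v\<close> from the
  support or leaves it there.\<close>

lemma mons_insert_Suc:
  assumes "v \<notin> (S :: ('v::finite) set)"
  shows "mons (insert v S) (Suc d) = (\<lambda>m. m + Poly_Mapping.single v 1) ` (mons S d \<union> mons (insert v S) d)"
proof (intro equalityI subsetI)
  fix m assume m: "m \<in> mons (insert v S) (Suc d)"
  define m' where "m' = m - Poly_Mapping.single v 1"
  have v: "v \<in> Poly_Mapping.keys m" using m by (auto simp: mons_def)
  have eq: "m = m' + Poly_Mapping.single v 1"
    by (rule poly_mapping_eqI)
      (use v in \<open>auto simp: m'_def lookup_add lookup_minus lookup_single when_def in_keys_iff\<close>)
  have "Poly_Mapping.keys m' - {v} = Poly_Mapping.keys m - {v}"
    by (auto simp: m'_def in_keys_iff lookup_minus lookup_single when_def)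
  then have "Poly_Mapping.keys m' - {v} = S"
    using m assms by (simp add: mons_def)
  then have "Poly_Mapping.keys m' = S \<or> Poly_Mapping.keys m' = insert v S" by blast
  moreover have "mon_deg m = mon_deg m' + 1"
    by (subst eq) (simp only: mon_deg_add mon_deg_single)
  then have "mon_deg m' = d" using m by (simp add: mons_def)
  ultimately show "m \<in> (\<lambda>m. m + Poly_Mapping.single v 1) ` (mons S d \<union> mons (insert v S) d)"
    using eq by (auto simp: mons_def)
next
  fix m assume "m \<in> (\<lambda>m. m + Poly_Mapping.single v 1) ` (mons S d \<union> mons (insert v S) d)"
  then obtain m' where m': "m' \<in> mons S d \<union> mons (insert v S) d" "m = m' + Poly_Mapping.single v 1"
    by (rule imageE)
  then have "insert v (Poly_Mapping.keys m') = insert v S" "mon_deg m' = d"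
    unfolding mons_def by auto
  then show "m \<in> mons (insert v S) (Suc d)"
    by (simp add: m'(2) mons_def keys_add_nat mon_deg_add mon_deg_single)
qed

lemma card_mons_insert_Suc:
  assumes "v \<notin> (S :: ('v::finite) set)"
  shows "card (mons (insert v S) (Suc d)) = card (mons S d) + card (mons (insert v S) d)"
proof -
  have "card (mons (insert v S) (Suc d)) = card (mons S d \<union> mons (insert v S) d)"
    unfolding mons_insert_Suc[OF assms] by (rule card_image) (simp add: inj_on_def)
  also have "\<dots> = card (mons S d) + card (mons (insert v S) d)"
    using assms by (intro card_Un_disjoint finite_mons) (auto simp: mons_def)
  finally show ?thesis .
qed

text \<open>Each vertex of the support contributes a factor t/(1 - t); the denominators are cleared
  to stay within integer power series.\<close>

lemma support_series:
  fixes S :: "('v::finite) set"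
  shows "Abs_fps (\<lambda>d. int (card (mons S d))) * (1 - fps_X) ^ card S = fps_X ^ card S"
  using finite[of S]
proof (induction S)
  case empty
  show ?case by (auto simp: fps_eq_iff mons_empty)
next
  case (insert v S)
  \<comment> \<open>Coefficientwise this is \<open>card_mons_insert_Suc\<close>, with
    \<open>mons_insert_0\<close> for the constant term.\<close>
  have step: "Abs_fps (\<lambda>d. int (card (mons (insert v S) d))) * (1 - fps_X) =
      fps_X * Abs_fps (\<lambda>d. int (card (mons S d)))" (is "?L = ?R")
  proof (rule fps_ext)
    fix n show "fps_nth ?L n = fps_nth ?R n"
      using insert.hyps by (cases n) (auto simp: right_diff_distrib mons_insert_0 card_mons_insert_Suc)
  qed
  have "Abs_fps (\<lambda>d. int (card (mons (insert v S) d))) * (1 - fps_X) ^ card (insert v S) =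
      (Abs_fps (\<lambda>d. int (card (mons (insert v S) d))) * (1 - fps_X)) * (1 - fps_X) ^ card S"
    using insert.hyps by (simp add: mult.assoc)
  also have "\<dots> = fps_X * (Abs_fps (\<lambda>d. int (card (mons S d))) * (1 - fps_X) ^ card S)"
    by (simp add: step mult.assoc)
  finally show ?case using insert by simp
qed

text \<open>The difference of dimensions counts the monomials outside the ideal, which are then
  grouped by support.\<close>

lemma hilb_fun_edge_ideal:
  fixes E :: "('v::finite) set set"
  shows "hilb_fun (edge_ideal E :: ('v, 'k::field) mpoly set) d = (\<Sum>S | indep E S. card (mons S d))"
proof -
  let ?M = "{m :: 'v \<Rightarrow>\<^sub>0 nat. mon_deg m = d}"
  let ?D = "{m :: 'v \<Rightarrow>\<^sub>0 nat. mon_deg m = d \<and> \<not> indep E (Poly_Mapping.keys m)}"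
  have "(homog d :: ('v, 'k) mpoly set) = {f. Poly_Mapping.keys f \<subseteq> ?M}"
    by (auto simp: homog_def)
  moreover have "edge_ideal E \<inter> (homog d :: ('v, 'k) mpoly set) = {f. Poly_Mapping.keys f \<subseteq> ?D}"
    by (auto simp: homog_def edge_ideal_eq_supp_ideal supp_ideal_def)
  moreover have fin: "finite ?D" by (rule finite_subset[OF _ finite_mon_deg[of d]]) auto
  ultimately have "hilb_fun (edge_ideal E :: ('v, 'k) mpoly set) d = card ?M - card ?D"
    unfolding hilb_fun_def by (simp add: dim_monomial_span finite_mon_deg)
  also have "\<dots> = card (?M - ?D)"
    using fin by (intro card_Diff_subset[symmetric]) auto
  also have "?M - ?D = (\<Union>S\<in>{S. indep E S}. mons S d)"
    by (auto simp: mons_def)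
  also have "card \<dots> = (\<Sum>S | indep E S. card (mons S d))"
    by (rule card_UN_disjoint) (auto simp: mons_def[abs_def] intro: finite_mons[unfolded mons_def])
  finally show ?thesis .
qed

section \<open>The h-polynomial and its degree\<close>

lemma fps_of_poly_one_minus_X: "fps_of_poly [:1, -1 :: int:] = 1 - fps_X"
  by (simp add: fps_of_poly_pCons)

text \<open>The usual passage from the f-vector of the independence complex to its h-polynomial,
  with common denominator (1 - t)^\<alpha>.\<close>

definition indep_h_poly :: "'v set set \<Rightarrow> nat \<Rightarrow> int poly" where
  "indep_h_poly E \<alpha> = (\<Sum>S | indep E S. monom 1 (card S) * [:1, -1:] ^ (\<alpha> - card S))"

lemma hilb_series_edge_ideal:
  fixes E :: "('v::finite) set set"
  assumes "\<And>S. indep E S \<Longrightarrow> card S \<le> \<alpha>"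
  shows "hilb_series (edge_ideal E :: ('v, 'k::field) mpoly set) * (1 - fps_X) ^ \<alpha> =
    fps_of_poly (indep_h_poly E \<alpha>)"
proof -
  have "hilb_series (edge_ideal E :: ('v, 'k) mpoly set) =
      (\<Sum>S | indep E S. Abs_fps (\<lambda>d. int (card (mons S d))))"
    by (simp add: fps_eq_iff hilb_series_def hilb_fun_edge_ideal fps_sum_nth)
  then have "hilb_series (edge_ideal E :: ('v, 'k) mpoly set) * (1 - fps_X) ^ \<alpha> =
      (\<Sum>S | indep E S. Abs_fps (\<lambda>d. int (card (mons S d))) * (1 - fps_X) ^ \<alpha>)"
    by (simp only: sum_distrib_right)
  also have "\<dots> = (\<Sum>S | indep E S. fps_X ^ card S * (1 - fps_X) ^ (\<alpha> - card S))"
  proof (rule sum.cong)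
    fix S assume "S \<in> {S. indep E S}"
    \<comment> \<open>The bound on \<open>card S\<close> makes the truncated difference of exponents
      exact.\<close>
    then have split: "(1 - fps_X :: int fps) ^ \<alpha> = (1 - fps_X) ^ card S * (1 - fps_X) ^ (\<alpha> - card S)"
      using assms[of S] by (simp add: power_add[symmetric])
    then show "Abs_fps (\<lambda>d. int (card (mons S d))) * (1 - fps_X) ^ \<alpha> =
        fps_X ^ card S * (1 - fps_X) ^ (\<alpha> - card S)"
      by (simp only: split mult.assoc[symmetric] support_series)
  qed simp
  also have "\<dots> = fps_of_poly (indep_h_poly E \<alpha>)"
    by (simp only: indep_h_poly_def fps_of_poly_sum fps_of_poly_mult fps_of_poly_power fps_of_poly_monom'
        fps_of_poly_one_minus_X)
  finally show ?thesis .
qed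

text \<open>At 1 only the sets of size \<open>\<alpha>\<close> survive, each contributing
  \<open>0 ^ 0 = 1\<close>, and \<open>S0\<close> is one of them.\<close>

lemma poly_indep_h_poly_1:
  fixes E :: "('v::finite) set set"
  assumes "\<And>S. indep E S \<Longrightarrow> card S \<le> \<alpha>" "indep E S0" "card S0 = \<alpha>"
  shows "poly (indep_h_poly E \<alpha>) 1 \<noteq> 0"
proof -
  have "poly (indep_h_poly E \<alpha>) 1 = (\<Sum>S | indep E S. 0 ^ (\<alpha> - card S))"
    by (simp add: indep_h_poly_def poly_sum poly_monom)
  also have "\<dots> > 0"
    using assms by (intro sum_pos2[of _ S0]) auto
  finally show ?thesis by simp
qed

text \<open>If the exponents differed, the numerator belonging to the larger one would contain a
  factor 1 - t and vanish at 1. This justifies the \<open>THE\<close> in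
  \<open>h_poly\<close>.\<close>

lemma hilbert_numerator_unique:
  fixes F :: "int fps"
  assumes "F * (1 - fps_X) ^ D = fps_of_poly p" "poly p 1 \<noteq> 0"
    and "F * (1 - fps_X) ^ D' = fps_of_poly q" "poly q 1 \<noteq> 0"
  shows "p = q"
proof -
  have wlog: "p = q"
    if "D \<le> D'" "F * (1 - fps_X) ^ D = fps_of_poly p" "F * (1 - fps_X) ^ D' = fps_of_poly q"
      "poly q 1 \<noteq> 0" for D D' p q
  proof -
    have "fps_of_poly q = F * (1 - fps_X) ^ D * (1 - fps_X) ^ (D' - D)"
      using that(1,3) by (simp add: mult.assoc power_add[symmetric])
    also have "\<dots> = fps_of_poly (p * [:1, -1:] ^ (D' - D))"
      by (simp add: that(2) fps_of_poly_mult fps_of_poly_power fps_of_poly_one_minus_X)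
    finally have q: "q = p * [:1, -1:] ^ (D' - D)" by (simp add: fps_of_poly_eq_iff)
    then have "poly q 1 = poly p 1 * 0 ^ (D' - D)" by simp
    then have "D' - D = 0" using that(4) by (cases "D' - D") auto
    then show ?thesis using q by simp
  qed
  show ?thesis
    using wlog[of D D' p q] wlog[of D' D q p] assms by (cases "D \<le> D'") auto
qed

lemma h_poly_edge_ideal:
  fixes E :: "('v::finite) set set"
  assumes "\<And>S. indep E S \<Longrightarrow> card S \<le> \<alpha>" "indep E S0" "card S0 = \<alpha>"
  shows "h_poly (edge_ideal E :: ('v, 'k::field) mpoly set) = indep_h_poly E \<alpha>"
  unfolding h_poly_def
proof (rule the_equality)
  note series = hilb_series_edge_ideal[OF assms(1), where ?'k='k]
  show "poly (indep_h_poly E \<alpha>) 1 \<noteq> 0 \<and> (\<exists>D. hilb_series (edge_ideal E :: ('v, 'k) mpoly set) *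
      (1 - fps_X) ^ D = fps_of_poly (indep_h_poly E \<alpha>))"
    using poly_indep_h_poly_1[OF assms] series by blast
  fix h assume "poly h 1 \<noteq> 0 \<and> (\<exists>D. hilb_series (edge_ideal E :: ('v, 'k) mpoly set) *
      (1 - fps_X) ^ D = fps_of_poly h)"
  then show "h = indep_h_poly E \<alpha>"
    using hilbert_numerator_unique[OF _ _ series poly_indep_h_poly_1[OF assms]] by blast
qed

lemma coeff_one_minus_X_power: "coeff ([:1, -1 :: int:] ^ n) n = (-1) ^ n"
proof -
  have "degree ([:1, -1 :: int:] ^ n) = n" by (simp add: degree_power_eq)
  then show ?thesis using lead_coeff_power[of "[:1, -1 :: int:]" n] by simp
qed

text \<open>Every summand has degree at most \<open>\<alpha>\<close>, and its coefficient there is a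
  sign; these signs add up to the alternating sum times \<open>(-1) ^ \<alpha>\<close>.\<close>

lemma degree_indep_h_poly:
  fixes E :: "('v::finite) set set"
  assumes "\<And>S. indep E S \<Longrightarrow> card S \<le> \<alpha>" "indep E S0" "card S0 = \<alpha>"
  shows "degree (indep_h_poly E \<alpha>) \<le> \<alpha>"
    and "degree (indep_h_poly E \<alpha>) = \<alpha> \<longleftrightarrow> (\<Sum>S | indep E S. (-1::int) ^ card S) \<noteq> 0"
proof -
  show le: "degree (indep_h_poly E \<alpha>) \<le> \<alpha>"
    unfolding indep_h_poly_def
  proof (rule degree_sum_le)
    fix S assume S: "S \<in> {S. indep E S}"
    have "degree (monom (1::int) (card S) * [:1, -1:] ^ (\<alpha> - card S)) \<le> card S + (\<alpha> - card S)"
      by (rule order_trans[OF degree_mult_le]) (simp add: degree_monom_eq degree_power_eq)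
    then show "degree (monom (1::int) (card S) * [:1, -1:] ^ (\<alpha> - card S)) \<le> \<alpha>"
      using assms(1)[of S] S by simp
  qed simp
  have "coeff (indep_h_poly E \<alpha>) \<alpha> = (\<Sum>S | indep E S. (-1) ^ (\<alpha> - card S))"
    unfolding indep_h_poly_def coeff_sum
    by (intro sum.cong refl)
      (use assms(1)[THEN leD] in \<open>auto simp: coeff_monom_mult coeff_one_minus_X_power\<close>)
  also have "\<dots> = (\<Sum>S | indep E S. (-1) ^ \<alpha> * (-1) ^ card S)"
    by (intro sum.cong refl) (use assms(1)[THEN leD] in \<open>auto simp: minus_one_power_iff\<close>)
  finally have coeff: "coeff (indep_h_poly E \<alpha>) \<alpha> = (-1) ^ \<alpha> * (\<Sum>S | indep E S. (-1) ^ card S)"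
    by (simp add: sum_distrib_left)
  \<comment> \<open>This matters for \<open>\<alpha> = 0\<close>: the zero polynomial also has
    degree 0, but its coefficient there vanishes.\<close>
  have "indep_h_poly E \<alpha> \<noteq> 0" using poly_indep_h_poly_1[OF assms] by auto
  then have "coeff (indep_h_poly E \<alpha>) \<alpha> \<noteq> 0 \<longleftrightarrow> degree (indep_h_poly E \<alpha>) = \<alpha>"
    using le by (metis le_antisym le_degree leading_coeff_0_iff)
  with coeff show "degree (indep_h_poly E \<alpha>) = \<alpha> \<longleftrightarrow> (\<Sum>S | indep E S. (-1::int) ^ card S) \<noteq> 0"
    by simp
qed

lemma degree_h_poly_edge_ideal:
  fixes E :: "('v::finite) set set"
  assumes "\<And>S. indep E S \<Longrightarrow> card S \<le> card S0" "indep E S0"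
  shows "degree (h_poly (edge_ideal E :: ('v, 'k::field) mpoly set)) \<le> card S0"
    and "degree (h_poly (edge_ideal E :: ('v, 'k) mpoly set)) = card S0 \<longleftrightarrow>
      (\<Sum>S | indep E S. (-1::int) ^ card S) \<noteq> 0"
proof -
  have h: "h_poly (edge_ideal E :: ('v, 'k) mpoly set) = indep_h_poly E (card S0)"
    by (rule h_poly_edge_ideal[OF assms refl])
  show "degree (h_poly (edge_ideal E :: ('v, 'k) mpoly set)) \<le> card S0"
    unfolding h by (rule degree_indep_h_poly(1)[OF assms refl])
  show "degree (h_poly (edge_ideal E :: ('v, 'k) mpoly set)) = card S0 \<longleftrightarrow>
      (\<Sum>S | indep E S. (-1::int) ^ card S) \<noteq> 0"
    unfolding h by (rule degree_indep_h_poly(2)[OF assms refl])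
qed

section \<open>The inequality and the case of equality\<close>

theorem theorem4p2:
  fixes E :: "('v::finite) set set"
  assumes "simple_graph E" and "E \<noteq> {}"
  defines "I \<equiv> (edge_ideal E :: ('v, 'k::field) mpoly set)"
  shows "v_number I + degree (h_poly I) \<le> card (UNIV :: 'v set) \<and>
         (v_number I + degree (h_poly I) = card (UNIV :: 'v set) \<longleftrightarrow> star_union E)"
proof -
  note E = assms(1)
  \<comment> \<open>A maximum independent set supplies both the independence number for the
    h-polynomial and the targets of the neighbour choice \<open>f\<close>.\<close>
  have "\<exists>S. indep E S \<and> (\<forall>T. indep E T \<longrightarrow> card T \<le> card S)"
    by (rule ex_has_greatest_nat[of _ "{}" _ "Suc (card (UNIV :: 'v set))"])
      (auto intro: indep_empty[OF E] card_mono simp: less_Suc_eq_le)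
  then obtain S where S: "indep E S" and max: "\<And>T. indep E T \<Longrightarrow> card T \<le> card S"
    by blast
  have maximal: "\<not> indep E (insert x S)" if "x \<notin> S" for x
    using max[of "insert x S"] that by auto
  have n: "card (UNIV :: 'v set) = card (- S) + card S"
    using card_Un_disjoint[of "- S" S] by (simp add: Compl_partition2)
  note deg = degree_h_poly_edge_ideal[OF max S, where ?'k='k, folded I_def]
  have "\<exists>y\<in>S. {y, c} \<in> E" if "c \<notin> S" for c
    using not_indep_insert[OF E S maximal[OF that]] unfolding nbhd_def by simp
  then obtain f where f: "\<And>c. c \<notin> S \<Longrightarrow> f c \<in> S \<and> {f c, c} \<in> E" by metis
  have cover: "cover_gen E (f ` (- S))" using E S f by (rule cover_gen_image)
  have v_le: "v_number I \<le> card A" if "cover_gen E A" for A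
    unfolding I_def using E that by (rule v_number_le_card)
  have "v_number I \<le> card (f ` (- S))" using cover by (rule v_le)
  also have "\<dots> \<le> card (- S)" by (rule card_image_le) simp
  finally have v: "v_number I \<le> card (- S)" .
  have le: "v_number I + degree (h_poly I) \<le> card (UNIV :: 'v set)" using v deg(1) n by simp
  have "star_union E" if eq: "v_number I + degree (h_poly I) = card (UNIV :: 'v set)"
  proof -
    \<comment> \<open>The two summands are bounded by \<open>card (- S)\<close> and
      \<open>card S\<close>, so equality of the sum forces both bounds to be attained.\<close>
    have "degree (h_poly I) = card S" and v_eq: "v_number I = card (- S)"
      using eq v deg(1) n by simp_all
    then have "(\<Sum>S | indep E S. (-1::int) ^ card S) \<noteq> 0" using deg(2) by simp
    then have "\<exists>e\<in>E. x \<in> e" for x using alternating_sum_isolated[of E x] by blast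
    then have "star_centers E (- S)"
      using star_centers_if_no_small_cover_gen[OF E S maximal] v_le v_eq by simp
    then show ?thesis by (rule star_centers_imp_star_union[OF E])
  qed
  moreover have "v_number I + degree (h_poly I) = card (UNIV :: 'v set)" if "star_union E"
  proof -
    obtain Z where Z: "star_centers E Z"
      using E \<open>star_union E\<close> by (rule star_union_imp_star_centers)
    obtain A where A: "cover_gen E A" "card A \<le> v_number I"
      by (rule v_number_cover_gen[OF E cover, where ?'k='k, folded I_def])
    \<comment> \<open>The v-number is at least \<open>card Z\<close>, and the degree is
      \<open>card S\<close>, which is at least the size of the independent set \<open>- Z\<close>;
      together they reach the number of vertices.\<close>
    have "card Z \<le> v_number I" using star_centers_card_le[OF Z A(1)] A(2) by simp
    moreover have "card (- Z) \<le> card S" using max star_centers_indep(2)[OF Z] by blast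
    moreover have "degree (h_poly I) = card S" using deg(2) alternating_sum_star[OF E Z] by simp
    moreover have "card (UNIV :: 'v set) = card (- Z) + card Z"
      using card_Un_disjoint[of "- Z" Z] by (simp add: Compl_partition2)
    ultimately show ?thesis using le by simp
  qed
  ultimately show ?thesis using le by blast
qed

end
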